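(* There exists a Besicovitch set $B=\bigcup\mathcal{L}\subseteq\mathbb{R}^2$, where $\mathcal{L}$ is a family of lines in the plane, such that: (1) $B$ is closed. (2) $B$ is of 2-dimensional Lebesgue measure zero. (3) For every line $e\subseteq\mathbb{R}^2$ with $e\notin\mathcal{L}$, the intersection $B\cap e$ is of 1-dimensional Lebesgue measure zero. (4) For every $e\in\mathcal{L}$, the intersection $e\cap\bigcup(\mathcal{L}\setminus\{e\})$ is of 1-dimensional Lebesgue measure zero. Moreover, these properties are typical in the following sense: for a typical $K'\in\mathcal{C}$, if $\mathcal{L}'$ is the dual of $K'$, and $\mathcal{L}$ denotes the union of the four families of lines obtained by rotating all lines of $\mathcal{L}'$ about the origin by the angles $0,\frac{\pi}{4},\frac{\pi}{2},\frac{3\pi}{4}$ respectively, then $B=\bigcup\mathcal{L}$ (which is the union of the four correspondingly rotated copies of $L'=\bigcup\mathcal{L}'$) is a Besicovitch set and $B$, $\mathcal{L}$ satisfy (1)–(4).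
   Context: A Besicovitch set in $\mathbb{R}^2$ is a set $B\subseteq\mathbb{R}^2$ which contains a (full) line in every direction. For $(a,b)\in\mathbb{R}^2$ let $l(a,b)$ denote the line with equation $y=ax+b$. The dual of a set $K\subseteq\mathbb{R}^2$ is the family of lines $\{l(a,b): (a,b)\in K\}$. $\mathcal{K}([0,1]^2)$ denotes the set of compact subsets of $[0,1]^2$ with the Hausdorff distance $d_H(K,L)=\max\{\inf\{\delta_1\ge 0: K\subseteq L_{\delta_1}\},\inf\{\delta_2\ge 0: L\subseteq K_{\delta_2}\}\}$, where $A_\delta$ is the open $\delta$-neighbourhood of $A$. Let $\mathcal{C}$ be the set of those $K\in\mathcal{K}([0,1]^2)$ whose orthogonal projection to the $x$-axis is the whole interval $[0,1]$; it is a closed subspace of $\mathcal{K}([0,1]^2)$, hence a complete metric space with $d_H$. A typical element of a complete metric space $X$ has property $P$ if $\{x\in X: P(x)\}$ is residual in $X$, i.e. its complement is of first category (a countable union of nowhere dense sets) in $X$. *)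

theory Defs
  imports "HOL-Analysis.Analysis"
begin

definition line :: "real \<times> real \<Rightarrow> real \<times> real \<Rightarrow> (real \<times> real) set" where
  "line p v = range (\<lambda>t::real. p + t *\<^sub>R v)"

definition is_line :: "(real \<times> real) set \<Rightarrow> bool" where
  "is_line e \<longleftrightarrow> (\<exists>p v. v \<noteq> 0 \<and> e = line p v)"

definition besicovitch_set :: "(real \<times> real) set \<Rightarrow> bool" where
  "besicovitch_set B \<longleftrightarrow> (\<forall>v. v \<noteq> 0 \<longrightarrow> (\<exists>p. line p v \<subseteq> B))"

text \<open>One-dimensional Lebesgue measure on a line is transported from the reals by an isometric
  parametrization; by \<open>null_on_line_iff\<close> below the choice of parametrization does not matter.\<close>

definition null_on_line :: "(real \<times> real) set \<Rightarrow> (real \<times> real) set \<Rightarrow> bool" where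
  "null_on_line e A \<longleftrightarrow>
     (\<exists>p v. norm v = 1 \<and> e = line p v \<and> {t::real. p + t *\<^sub>R v \<in> A} \<in> null_sets lebesgue)"

lemma null_on_line_iff:
  assumes "norm v = 1"
  shows "null_on_line (line p v) A \<longleftrightarrow> {t::real. p + t *\<^sub>R v \<in> A} \<in> null_sets lebesgue"
proof
  assume "null_on_line (line p v) A"
  then obtain q w where w: "norm w = 1" and eq: "line p v = line q w"
    and null: "{t::real. q + t *\<^sub>R w \<in> A} \<in> null_sets lebesgue"
    unfolding null_on_line_def by blast
  have "p + 0 *\<^sub>R v \<in> line q w" "p + 1 *\<^sub>R v \<in> line q w"
    using eq unfolding line_def by blast+
  then obtain s s' where s: "p = q + s *\<^sub>R w" and s': "p + v = q + s' *\<^sub>R w"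
    unfolding line_def by (metis (no_types, lifting) imageE scaleR_zero_left add_0_right scaleR_one)
  have v: "v = (s' - s) *\<^sub>R w"
    using s s' by (simp add: algebra_simps)
  define c where "c = s' - s"
  have c: "c = 1 \<or> c = -1"
    using assms w v by (auto simp: c_def)
  have "{t::real. p + t *\<^sub>R v \<in> A} = (\<lambda>t. c *\<^sub>R (t - s)) ` {t. q + t *\<^sub>R w \<in> A}" (is "?S = ?T")
  proof (intro set_eqI iffI)
    fix t assume "t \<in> ?S"
    then have "q + (s + c * t) *\<^sub>R w \<in> A"
      by (simp add: s v c_def algebra_simps)
    moreover have "t = c *\<^sub>R ((s + c * t) - s)"
      using c by auto
    ultimately show "t \<in> ?T" by blast
  next
    fix t assume "t \<in> ?T"
    then obtain u where u: "q + u *\<^sub>R w \<in> A" and t: "t = c *\<^sub>R (u - s)" by blast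
    have "p + t *\<^sub>R v = q + (s + c * c * (u - s)) *\<^sub>R w"
      unfolding s t v c_def[symmetric] by (simp add: scaleR_add_left mult.assoc mult.left_commute)
    also have "s + c * c * (u - s) = u" using c by auto
    finally show "t \<in> ?S" using u by simp
  qed
  moreover have "negligible ((\<lambda>t. c *\<^sub>R (t - s)) ` {t. q + t *\<^sub>R w \<in> A})"
    by (rule negligible_differentiable_image_negligible)
       (use null in \<open>auto simp: negligible_iff_null_sets differentiable_on_def intro!: derivative_intros\<close>)
  ultimately show "{t::real. p + t *\<^sub>R v \<in> A} \<in> null_sets lebesgue"
    by (simp add: negligible_iff_null_sets)
qed (use assms null_on_line_def in blast)

definition l :: "real \<Rightarrow> real \<Rightarrow> (real \<times> real) set" where
  "l a b = {(x, y). y = a * x + b}"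

definition dual :: "(real \<times> real) set \<Rightarrow> (real \<times> real) set set" where
  "dual K = {l a b | a b. (a, b) \<in> K}"

definition rot :: "real \<Rightarrow> real \<times> real \<Rightarrow> real \<times> real" where
  "rot \<theta> = (\<lambda>(x, y). (cos \<theta> * x - sin \<theta> * y, sin \<theta> * x + cos \<theta> * y))"

definition four_angles :: "real set" where
  "four_angles = {0, pi / 4, pi / 2, 3 * pi / 4}"

definition four_rotations :: "(real \<times> real) set set \<Rightarrow> (real \<times> real) set set" where
  "four_rotations L' = (\<Union>\<theta>\<in>four_angles. (\<lambda>e. rot \<theta> ` e) ` L')"

definition small_line_intersections :: "(real \<times> real) set set \<Rightarrow> bool" where
  "small_line_intersections L \<longleftrightarrow>
     closed (\<Union>L) \<and>
     \<Union>L \<in> null_sets lebesgue \<and>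
     (\<forall>e. is_line e \<and> e \<notin> L \<longrightarrow> null_on_line e (\<Union>L \<inter> e)) \<and>
     (\<forall>e\<in>L. null_on_line e (e \<inter> \<Union>(L - {e})))"

definition nbhd :: "real \<Rightarrow> 'a::metric_space set \<Rightarrow> 'a set" where
  "nbhd \<delta> A = (\<Union>a\<in>A. ball a \<delta>)"

definition hausdorff_excess :: "'a::metric_space set \<Rightarrow> 'a set \<Rightarrow> real" where
  "hausdorff_excess K L = Inf {\<delta>. 0 \<le> \<delta> \<and> K \<subseteq> nbhd \<delta> L}"

text \<open>The value \<open>0\<close> outside the nonempty bounded sets is a dummy: there the infimum may be over
  the empty set, and the locale \<open>Metric_space\<close> demands nonnegativity of the distance everywhere.\<close>

definition hausdorff_dist :: "'a::metric_space set \<Rightarrow> 'a set \<Rightarrow> real" where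
  "hausdorff_dist K L =
     (if K \<noteq> {} \<and> bounded K \<and> L \<noteq> {} \<and> bounded L
      then max (hausdorff_excess K L) (hausdorff_excess L K) else 0)"

definition CC :: "(real \<times> real) set set" where
  "CC = {K. compact K \<and> K \<subseteq> {0..1} \<times> {0..1} \<and> fst ` K = {0..1}}"

lemma nbhd_mono: "r \<le> s \<Longrightarrow> nbhd r A \<subseteq> nbhd s A"
  by (force simp: nbhd_def)

lemma hausdorff_excess_le: "0 \<le> r \<Longrightarrow> K \<subseteq> nbhd r L \<Longrightarrow> hausdorff_excess K L \<le> r"
  unfolding hausdorff_excess_def by (rule cInf_lower) (auto intro!: bdd_belowI[of _ 0])

lemma hausdorff_radii_nonempty:
  assumes "L \<noteq> {}" "bounded K"
  shows "{\<delta>. 0 \<le> \<delta> \<and> K \<subseteq> nbhd \<delta> L} \<noteq> {}"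
proof -
  obtain a where a: "a \<in> L" using assms by blast
  obtain r where r: "\<And>x. x \<in> K \<Longrightarrow> dist a x \<le> r"
    using assms(2) bounded_any_center[of K a] by blast
  have "K \<subseteq> nbhd (\<bar>r\<bar> + 1) L"
    using a r by (force simp: nbhd_def)
  then show ?thesis
    by (metis (mono_tags, lifting) abs_ge_zero add_nonneg_nonneg empty_iff mem_Collect_eq zero_le_one)
qed

lemma hausdorff_excess_nonneg:
  assumes "L \<noteq> {}" "bounded K" shows "0 \<le> hausdorff_excess K L"
  unfolding hausdorff_excess_def
  by (rule cInf_greatest[OF hausdorff_radii_nonempty[OF assms]]) auto

lemma subset_nbhd_if_excess_less:
  assumes "L \<noteq> {}" "bounded K" "hausdorff_excess K L < r" shows "K \<subseteq> nbhd r L"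
proof -
  obtain d where "d < r" "K \<subseteq> nbhd d L"
    using cInf_lessD[OF hausdorff_radii_nonempty[OF assms(1,2)], of r] assms(3)
    unfolding hausdorff_excess_def by auto
  then show ?thesis using nbhd_mono[of d r L] by auto
qed

lemma hausdorff_excess_triangle:
  assumes "L \<noteq> {}" "bounded L" "M \<noteq> {}" "bounded K"
  shows "hausdorff_excess K M \<le> hausdorff_excess K L + hausdorff_excess L M"
proof (rule field_le_epsilon)
  fix e :: real assume e: "0 < e"
  let ?a = "hausdorff_excess K L + e / 2" and ?b = "hausdorff_excess L M + e / 2"
  have "K \<subseteq> nbhd ?a L" "L \<subseteq> nbhd ?b M"
    using assms e by (simp_all add: subset_nbhd_if_excess_less)
  have "K \<subseteq> nbhd (?a + ?b) M"
  proof
    fix x assume "x \<in> K"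
    then obtain y where y: "y \<in> L" "dist y x < ?a"
      using \<open>K \<subseteq> nbhd ?a L\<close> by (auto simp: nbhd_def)
    then obtain z where z: "z \<in> M" "dist z y < ?b"
      using \<open>L \<subseteq> nbhd ?b M\<close> by (auto simp: nbhd_def)
    have "dist z x < ?a + ?b"
      using dist_triangle[of z x y] y z by linarith
    then show "x \<in> nbhd (?a + ?b) M" using z by (auto simp: nbhd_def)
  qed
  moreover have "0 \<le> ?a + ?b"
    using assms e hausdorff_excess_nonneg[of L K] hausdorff_excess_nonneg[of M L] by auto
  ultimately have "hausdorff_excess K M \<le> ?a + ?b"
    by (intro hausdorff_excess_le)
  then show "hausdorff_excess K M \<le> hausdorff_excess K L + hausdorff_excess L M + e"
    by (simp add: field_simps)
qed

lemma subset_if_excess_zero: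
  assumes "L \<noteq> {}" "bounded K" "closed L" "hausdorff_excess K L \<le> 0"
  shows "K \<subseteq> L"
proof
  fix x assume x: "x \<in> K"
  have "\<exists>y\<in>L. dist y x < e" if "e > 0" for e
    using subset_nbhd_if_excess_less[of L K e] assms that x by (auto simp: nbhd_def)
  then have "x \<in> closure L" by (simp add: closure_approachable)
  then show "x \<in> L" using assms by simp
qed

lemma hausdorff_excess_self:
  assumes "K \<noteq> {}" "bounded K" shows "hausdorff_excess K K = 0"
proof (rule antisym)
  show "hausdorff_excess K K \<le> 0"
  proof (rule field_le_epsilon)
    fix e :: real assume "0 < e"
    then have "K \<subseteq> nbhd e K" by (auto simp: nbhd_def)
    then show "hausdorff_excess K K \<le> 0 + e"
      using \<open>0 < e\<close> by (simp add: hausdorff_excess_le)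
  qed
qed (use assms hausdorff_excess_nonneg in blast)

lemma CC_D:
  assumes "K \<in> CC" shows "K \<noteq> {}" "bounded K" "closed K"
  using assms by (auto simp: CC_def compact_imp_bounded compact_imp_closed)

lemma Metric_space_CC: "Metric_space CC hausdorff_dist"
proof
  fix K L :: "(real \<times> real) set"
  show "0 \<le> hausdorff_dist K L"
    by (simp add: hausdorff_dist_def hausdorff_excess_nonneg le_max_iff_disj)
  show "hausdorff_dist K L = hausdorff_dist L K"
    by (simp add: hausdorff_dist_def max.commute)
next
  fix K L assume "K \<in> CC" "L \<in> CC"
  note [simp] = CC_D[OF this(1)] CC_D[OF this(2)]
  show "hausdorff_dist K L = 0 \<longleftrightarrow> K = L"
  proof
    assume "hausdorff_dist K L = 0"
    then have "hausdorff_excess K L \<le> 0" "hausdorff_excess L K \<le> 0"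
      by (simp_all add: hausdorff_dist_def max_def split: if_splits)
    then show "K = L"
      by (intro equalityI subset_if_excess_zero) simp_all
  qed (simp add: hausdorff_dist_def hausdorff_excess_self)
next
  fix K L M assume "K \<in> CC" "L \<in> CC" "M \<in> CC"
  note [simp] = CC_D[OF this(1)] CC_D[OF this(2)] CC_D[OF this(3)]
  show "hausdorff_dist K M \<le> hausdorff_dist K L + hausdorff_dist L M"
    using hausdorff_excess_triangle[of L M K] hausdorff_excess_triangle[of L K M]
    by (simp add: hausdorff_dist_def max_def)
qed

definition CC_topology :: "(real \<times> real) set topology" where
  "CC_topology = Metric_space.mtopology CC hausdorff_dist"

lemma topspace_CC_topology [simp]: "topspace CC_topology = CC"
  by (simp add: CC_topology_def Metric_space.topspace_mtopology[OF Metric_space_CC])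

definition nowhere_dense_in :: "'a topology \<Rightarrow> 'a set \<Rightarrow> bool" where
  "nowhere_dense_in X S \<longleftrightarrow> S \<subseteq> topspace X \<and> X interior_of (X closure_of S) = {}"

definition first_category_in :: "'a topology \<Rightarrow> 'a set \<Rightarrow> bool" where
  "first_category_in X S \<longleftrightarrow>
     (\<exists>N :: nat \<Rightarrow> 'a set. (\<forall>n. nowhere_dense_in X (N n)) \<and> S = (\<Union>n. N n))"

definition residual_in :: "'a topology \<Rightarrow> 'a set \<Rightarrow> bool" where
  "residual_in X S \<longleftrightarrow> S \<subseteq> topspace X \<and> first_category_in X (topspace X - S)"

definition typical_in :: "'a topology \<Rightarrow> ('a \<Rightarrow> bool) \<Rightarrow> bool" where
  "typical_in X P \<longleftrightarrow> residual_in X {x \<in> topspace X. P x}"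

end

theory Submission
  imports Defs
begin

text \<open>A point \<open>(x, y)\<close> lies on the line \<open>l a b\<close> iff \<open>a * x + b = y\<close>, so vertical lines meet the dual
  of \<open>K\<close> in projections of \<open>K\<close>, and the line \<open>l c d\<close> meets the other lines of the dual in (a reflected
  copy of) the set of slopes of \<open>K\<close> seen from \<open>(c, d)\<close>. All claims therefore follow if for a typical \<open>K\<close>
  every such projection and every such set of slopes is null, without exceptional centres.

  This is achieved by a variant of Koerner's Baire category argument. Near a fixed centre, any \<open>K0\<close> can be
  replaced by finitely many points and short segments pointing at that centre, whose total length over the
  first axis is \<open>1\<close>. Seen from any centre at distance at most \<open>\<eta>\<close> from the fixed one, the slopes of this set
  and of all compact sets close to it have measure \<open>O(\<eta>)\<close>. Countably many pairs (centre, \<open>\<eta>\<close>)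
  suffice, and letting \<open>\<eta>\<close> tend to zero gives measure zero for every centre simultaneously.\<close>

subsection \<open>Robustly dense properties are typical\<close>

text \<open>The inner condition is one-sided: \<open>K'\<close> need only lie inside a neighbourhood
  of \<open>K\<close>. This includes every \<open>K'\<close> in a Hausdorff ball around
  \<open>K\<close>, and it also applies to a nested intersection that is not known to be Hausdorff
  close to \<open>K\<close>.\<close>

definition robustly_dense :: "((real \<times> real) set \<Rightarrow> bool) \<Rightarrow> bool" where
  "robustly_dense Q \<longleftrightarrow>
     (\<forall>K0\<in>CC. \<forall>\<epsilon>>0. \<exists>K\<in>CC. \<exists>r>0. hausdorff_dist K K0 < \<epsilon> \<and> (\<forall>K'\<in>CC. K' \<subseteq> nbhd r K \<longrightarrow> Q K'))"

lemma robustly_denseD: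
  assumes "robustly_dense Q" "K0 \<in> CC" "0 < \<epsilon>"
  shows "\<exists>K r. K \<in> CC \<and> 0 < r \<and> hausdorff_dist K K0 < \<epsilon> \<and> (\<forall>K'\<in>CC. K' \<subseteq> nbhd r K \<longrightarrow> Q K')"
  using assms unfolding robustly_dense_def by meson

lemma subset_nbhd_if_hausdorff_dist_less:
  assumes "K \<in> CC" "L \<in> CC" "hausdorff_dist K L < r"
  shows "K \<subseteq> nbhd r L"
  using assms CC_D[OF assms(1)] CC_D[OF assms(2)]
  by (intro subset_nbhd_if_excess_less) (auto simp: hausdorff_dist_def)

lemma subset_nbhd: "0 < r \<Longrightarrow> K \<subseteq> nbhd r K"
  by (auto simp: nbhd_def)

text \<open>A ball inside the closure of the exceptional set would contain some \<open>K\<close> all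
  of whose sufficiently close neighbours satisfy \<open>Q\<close>. Such a \<open>K\<close> cannot
  lie in that closure.\<close>

lemma nowhere_dense_if_robustly_dense:
  assumes "robustly_dense Q"
  shows "nowhere_dense_in CC_topology {K \<in> CC. \<not> Q K}"
proof -
  interpret Metric_space CC hausdorff_dist by (rule Metric_space_CC)
  let ?N = "{K \<in> CC. \<not> Q K}"
  have False if K0: "K0 \<in> mtopology interior_of (mtopology closure_of ?N)" for K0
  proof -
    have "openin mtopology (mtopology interior_of (mtopology closure_of ?N))" by simp
    then obtain \<epsilon> where \<epsilon>: "\<epsilon> > 0" "mball K0 \<epsilon> \<subseteq> mtopology interior_of (mtopology closure_of ?N)"
      using K0 unfolding openin_mtopology by blast
    have "K0 \<in> CC" using K0 interior_of_subset_topspace[of mtopology] by auto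
    then obtain K r where K: "K \<in> CC" "0 < r" "hausdorff_dist K K0 < \<epsilon>"
      and Q: "\<forall>K'\<in>CC. K' \<subseteq> nbhd r K \<longrightarrow> Q K'"
      using robustly_denseD[OF assms _ \<epsilon>(1), of K0] by blast
    have "K \<in> mball K0 \<epsilon>" using K \<open>K0 \<in> CC\<close> commute[of K K0] unfolding in_mball by metis
    then have "K \<in> mtopology closure_of ?N" using subset_trans[OF \<epsilon>(2) interior_of_subset] by (rule subsetD[rotated])
    moreover have "K \<in> mball K r" using K by simp
    ultimately obtain K' where K': "K' \<in> ?N" "K' \<in> mball K r"
      unfolding in_closure_of using openin_mball[of K r] by blast
    then have "K' \<subseteq> nbhd r K"
      using subset_nbhd_if_hausdorff_dist_less[of K' K r] commute[of K K'] unfolding in_mball by simp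
    then show False using Q K' by blast
  qed
  then show ?thesis
    unfolding nowhere_dense_in_def by (auto simp: CC_topology_def)
qed

text \<open>Wherever \<open>R\<close> fails, some \<open>Q\<close> fails, so the exceptional set is
  covered by countably many nowhere dense sets.\<close>

lemma typical_if_robustly_dense:
  assumes "countable \<Q>" and dense: "\<And>Q. Q \<in> \<Q> \<Longrightarrow> robustly_dense Q"
    and R: "\<And>K. K \<in> CC \<Longrightarrow> (\<And>Q. Q \<in> \<Q> \<Longrightarrow> Q K) \<Longrightarrow> R K"
  shows "typical_in CC_topology R"
proof -
  have mono: "nowhere_dense_in CC_topology A" if "nowhere_dense_in CC_topology B" "A \<subseteq> B"
    for A B :: "(real \<times> real) set set"
    using that interior_of_mono[OF closure_of_mono[OF that(2)], of CC_topology CC_topology]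
    unfolding nowhere_dense_in_def by blast
  \<comment> \<open>The trivially true property is added so that the enumerated family is
    nonempty.\<close>
  define f where "f = from_nat_into (insert (\<lambda>_. True) \<Q>)"
  have range_f: "range f = insert (\<lambda>_. True) \<Q>"
    unfolding f_def by (rule range_from_nat_into) (use assms(1) in auto)
  have "robustly_dense (\<lambda>_. True)"
    unfolding robustly_dense_def
    by (metis Metric_space.mdist_zero Metric_space_CC zero_less_one)
  then have f: "robustly_dense (f n)" for n
    using dense range_f by (metis insertE rangeI)
  \<comment> \<open>Cutting down to the failures of \<open>R\<close> turns the covering into the
    equality that \<open>first_category_in\<close> asks for.\<close>
  define N where "N n = {K \<in> CC. \<not> f n K} \<inter> {K \<in> CC. \<not> R K}" for n
  have "CC - {K \<in> CC. R K} \<subseteq> (\<Union>n. N n)"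
  proof
    fix K assume K: "K \<in> CC - {K \<in> CC. R K}"
    then obtain Q where "Q \<in> \<Q>" "\<not> Q K" using R by blast
    moreover obtain n where "f n = Q" using range_f \<open>Q \<in> \<Q>\<close> by (metis insertI2 imageE)
    ultimately show "K \<in> (\<Union>n. N n)" using K by (auto simp: N_def)
  qed
  then have "CC - {K \<in> CC. R K} = (\<Union>n. N n)" by (auto simp: N_def)
  moreover have "nowhere_dense_in CC_topology (N n)" for n
    by (rule mono[OF nowhere_dense_if_robustly_dense[OF f]]) (auto simp: N_def)
  ultimately show ?thesis
    unfolding typical_in_def residual_in_def first_category_in_def by auto
qed

section \<open>A common member by nested neighbourhoods\<close>

text \<open>The construction from Baire's theorem, carried out in the plane instead of in
  \<open>CC\<close>: each neighbourhood contains the closure of the next, and the intersection of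
  these closures within the unit square is itself the required set.\<close>

lemma robustly_dense_nonempty:
  fixes Q :: "nat \<Rightarrow> (real \<times> real) set \<Rightarrow> bool"
  assumes "\<And>n. robustly_dense (Q n)"
  shows "\<exists>K\<in>CC. \<forall>n. Q n K"
proof -
  let ?P = "\<lambda>n (K, r). K \<in> CC \<and> 0 < r \<and> (\<forall>K'\<in>CC. K' \<subseteq> nbhd r K \<longrightarrow> Q n K')"
  let ?R = "\<lambda>(K, r) (K', r'). closure (nbhd r' K') \<subseteq> nbhd (r::real) K"
  have sq: "{0..1} \<times> {0} \<in> CC"
    by (auto simp: CC_def compact_Times)
  have "\<exists>f. \<forall>n. ?P n (f n) \<and> ?R (f n) (f (Suc n))"
  proof (rule dependent_nat_choice)
    show "\<exists>x. ?P 0 x"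
      using robustly_denseD[OF assms[of 0] sq zero_less_one] by (simp add: split_beta) (metis fst_conv snd_conv)
  next
    fix x n assume Px: "?P n x"
    obtain K r where x: "x = (K, r)" by (cases x)
    have "r / 2 > 0" using Px x by simp
    then obtain L s where L: "L \<in> CC" "0 < s" "hausdorff_dist L K < r / 2"
      "\<forall>K'\<in>CC. K' \<subseteq> nbhd s L \<longrightarrow> Q (Suc n) K'"
      using robustly_denseD[OF assms[of "Suc n"], of K "r / 2"] Px x by auto
    have LK: "L \<subseteq> nbhd (r / 2) K"
      using subset_nbhd_if_hausdorff_dist_less[OF L(1) _ L(3)] Px x by simp
    \<comment> \<open>The bound \<open>r / 4\<close> makes the distances add up:
      \<open>r / 4\<close> for the closure, \<open>r / 4\<close> for the new neighbourhood and
      \<open>r / 2\<close> from \<open>L\<close> to \<open>K\<close>.\<close>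
    define u where "u = min s (r / 4)"
    have "?P (Suc n) (L, u)"
      using L Px x nbhd_mono[of u s L] by (auto simp: u_def)
    moreover have "closure (nbhd u L) \<subseteq> nbhd r K"
    proof
      fix z assume "z \<in> closure (nbhd u L)"
      then obtain y where y: "y \<in> nbhd u L" "dist y z < r / 4"
        using Px x by (metis (no_types, lifting) case_prodD closure_approachable divide_pos_pos zero_less_numeral)
      then obtain a where a: "a \<in> L" "dist a y < u" by (auto simp: nbhd_def)
      then obtain b where b: "b \<in> K" "dist b a < r / 2"
        using LK by (force simp: nbhd_def)
      have "dist b z < r"
        using y a b dist_triangle[of b z a] dist_triangle[of a z y] by (auto simp: u_def)
      then show "z \<in> nbhd r K" using b by (auto simp: nbhd_def)
    qed
    ultimately show "\<exists>y. ?P (Suc n) y \<and> ?R x y" using x by auto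
  qed
  then obtain f where "\<forall>n. ?P n (f n) \<and> ?R (f n) (f (Suc n))" by (rule exE)
  then have f: "?P n (f n)" "?R (f n) (f (Suc n))" for n by simp_all
  define A where "A n = nbhd (snd (f n)) (fst (f n))" for n
  define T where "T n = closure (A n) \<inter> ({0..1} \<times> {0..1})" for n
  have A: "closure (A (Suc n)) \<subseteq> A n" for n
    using f(2)[of n] by (auto simp: A_def split: prod.splits)
  have f_CC: "fst (f n) \<in> CC" "fst (f n) \<subseteq> T n" for n
    using f(1)[of n] subset_nbhd[of "snd (f n)" "fst (f n)"] closure_subset[of "A n"]
    by (auto simp: T_def A_def CC_def split: prod.splits)
  have compact_T: "compact (T n)" for n
    unfolding T_def by (intro closed_Int_compact compact_Times) auto
  have dec: "T n \<subseteq> T m" if "m \<le> n" for m n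
    by (rule lift_Suc_antimono_le[OF _ that]) (use A closure_subset in \<open>fastforce simp: T_def\<close>)
  have "fst ` (\<Inter>n. T n) = {0..1}"
  proof
    show "{0..1} \<subseteq> fst ` (\<Inter>n. T n)"
    proof
      fix a :: real assume a: "a \<in> {0..1}"
      \<comment> \<open>The vertical fibres over \<open>a\<close> are nonempty, compact and
        decreasing, so a point over \<open>a\<close> survives in the intersection.\<close>
      let ?F = "\<lambda>n. T n \<inter> ({a} \<times> UNIV)"
      have "\<Inter> (range ?F) \<noteq> {}"
      proof (rule compact_nest)
        show "compact (?F n)" for n
          by (intro compact_Int_closed compact_T closed_Times) auto
        show "?F n \<noteq> {}" for n
        proof -
          have "a \<in> fst ` fst (f n)" using f_CC(1)[of n] a by (simp add: CC_def)
          then show ?thesis using f_CC(2)[of n] by force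
        qed
        show "?F n \<subseteq> ?F m" if "m \<le> n" for m n using dec[OF that] by blast
      qed
      then show "a \<in> fst ` (\<Inter>n. T n)" by force
    qed
  qed (auto simp: T_def)
  moreover have "compact (\<Inter>n. T n)" using compact_T by (intro compact_Inter) auto
  ultimately have "(\<Inter>n. T n) \<in> CC" by (auto simp: CC_def T_def)
  moreover have "Q n (\<Inter>n. T n)" for n
  proof -
    have "(\<Inter>n. T n) \<subseteq> A n" using A[of n] by (auto simp: T_def)
    with f(1)[of n] \<open>(\<Inter>n. T n) \<in> CC\<close> show ?thesis by (auto simp: A_def split: prod.splits)
  qed
  ultimately show ?thesis by blast
qed

subsection \<open>Tilting segments\<close>

text \<open>Smallness means outer measure, expressed by a measurable cover, so the images need not
  be shown measurable. One bound serves all parameters \<open>p\<close> in \<open>P\<close>, which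
  is how countably many conditions control uncountably many maps. The set \<open>D p\<close> cuts
  out points where \<phi> \<open>p\<close> is singular.\<close>

definition small_images ::
  "'i set \<Rightarrow> ('i \<Rightarrow> (real \<times> real) set) \<Rightarrow> ('i \<Rightarrow> real \<times> real \<Rightarrow> real) \<Rightarrow> real \<Rightarrow> (real \<times> real) set \<Rightarrow> bool"
  where "small_images P D \<phi> \<kappa> K \<longleftrightarrow>
    (\<forall>p\<in>P. \<exists>T\<in>lmeasurable. \<phi> p ` (K \<inter> D p) \<subseteq> T \<and> measure lebesgue T \<le> \<kappa>)"

text \<open>From every base point \<open>q\<close> of the unit square there is a direction \<open>(1, s)\<close> along which all the
  maps \<open>\<phi> p\<close> move at speed at most \<open>\<kappa>\<close>.\<close>

definition tiltable ::
  "'i set \<Rightarrow> ('i \<Rightarrow> (real \<times> real) set) \<Rightarrow> ('i \<Rightarrow> real \<times> real \<Rightarrow> real) \<Rightarrow> real \<Rightarrow> bool"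
  where "tiltable P D \<phi> \<kappa> \<longleftrightarrow>
    (\<exists>M C \<rho>. 0 < \<rho> \<and> 0 \<le> C \<and>
      (\<forall>q\<in>{0..1} \<times> {0..1}. \<exists>s. \<bar>s\<bar> \<le> M \<and>
        (\<forall>p\<in>P. \<exists>v. \<forall>t r q'. 0 \<le> t \<and> t \<le> \<rho> \<and> 0 \<le> r \<and> r \<le> \<rho> \<and> q' \<in> D p \<and> dist (q + t *\<^sub>R (1, s)) q' < r
            \<longrightarrow> \<bar>\<phi> p q' - v\<bar> \<le> \<kappa> * t + C * r)))"

lemma finite_intervals_cover:
  fixes v :: "'i \<Rightarrow> real"
  assumes "finite I" "0 \<le> w" "real (card I) * (2 * w) \<le> \<kappa>"
  shows "(\<Union>i\<in>I. {v i - w..v i + w}) \<in> lmeasurable"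
    "measure lebesgue (\<Union>i\<in>I. {v i - w..v i + w}) \<le> \<kappa>"
proof -
  show "(\<Union>i\<in>I. {v i - w..v i + w}) \<in> lmeasurable"
    by (intro fmeasurable.finite_UN assms) auto
  have "measure lebesgue (\<Union>i\<in>I. {v i - w..v i + w}) \<le> (\<Sum>i\<in>I. measure lebesgue {v i - w..v i + w})"
    by (intro measure_UNION_le assms) auto
  also have "\<dots> = real (card I) * (2 * w)" using assms(2) by simp
  finally show "measure lebesgue (\<Union>i\<in>I. {v i - w..v i + w}) \<le> \<kappa>" using assms(3) by simp
qed

lemma dist_real_pair_le: "dist (a, b) (c, d) \<le> \<bar>a - c\<bar> + \<bar>b - d\<bar>" for a b c d :: real
  using norm_Pair_le[of "a - c" "b - d"] by (simp add: dist_norm)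

text \<open>\<open>K0\<close> is replaced by a finite net of itself together with \<open>N\<close> short segments over the
  intervals \<open>[j / N, (j + 1) / N]\<close>, each tilted so that the maps barely vary along it. The segments
  contribute at most \<open>2 \<kappa> (1 / N)\<close> each, hence \<open>2 \<kappa>\<close> altogether, however large \<open>N\<close> is.\<close>

lemma robustly_dense_small_images:
  assumes "0 < \<kappa>" "tiltable P D \<phi> \<kappa>"
  shows "robustly_dense (small_images P D \<phi> (3 * \<kappa>))"
  unfolding robustly_dense_def
proof (intro ballI allI impI)
  fix K0 :: "(real \<times> real) set" and \<epsilon> :: real
  assume K0: "K0 \<in> CC" and \<epsilon>: "0 < \<epsilon>"
  obtain M C \<rho> where \<rho>: "0 < \<rho>" and C: "0 \<le> C" and
    "\<forall>q\<in>{0..1} \<times> {0..1}. \<exists>s. \<bar>s\<bar> \<le> M \<and>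
      (\<forall>p\<in>P. \<exists>v. \<forall>t r q'. 0 \<le> t \<and> t \<le> \<rho> \<and> 0 \<le> r \<and> r \<le> \<rho> \<and> q' \<in> D p \<and> dist (q + t *\<^sub>R (1, s)) q' < r
          \<longrightarrow> \<bar>\<phi> p q' - v\<bar> \<le> \<kappa> * t + C * r)"
    using assms(2) unfolding tiltable_def by blast
  then obtain s where s: "\<And>q. q \<in> {0..1} \<times> {0..1} \<Longrightarrow> \<bar>s q\<bar> \<le> M"
    and ex_v: "\<forall>q\<in>{0..1} \<times> {0..1}. \<forall>p\<in>P. \<exists>v. \<forall>t r q'. 0 \<le> t \<and> t \<le> \<rho> \<and> 0 \<le> r \<and> r \<le> \<rho> \<and> q' \<in> D p \<and>
        dist (q + t *\<^sub>R (1, s q)) q' < r \<longrightarrow> \<bar>\<phi> p q' - v\<bar> \<le> \<kappa> * t + C * r"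
    by metis
  from ex_v obtain v where v: "\<And>q p t r q'. q \<in> {0..1} \<times> {0..1} \<Longrightarrow> p \<in> P \<Longrightarrow> 0 \<le> t \<Longrightarrow> t \<le> \<rho> \<Longrightarrow>
      0 \<le> r \<Longrightarrow> r \<le> \<rho> \<Longrightarrow> q' \<in> D p \<Longrightarrow> dist (q + t *\<^sub>R (1, s q)) q' < r \<Longrightarrow> \<bar>\<phi> p q' - v q p\<bar> \<le> \<kappa> * t + C * r"
    by metis
  have M: "0 \<le> M" using s[of "(0, 0)"] by simp
  define \<delta> where "\<delta> = \<epsilon> / 2"
  have \<delta>: "0 < \<delta>" using \<epsilon> by (simp add: \<delta>_def)
  \<comment> \<open>The first summand makes a segment stay within \<delta> of \<open>K0\<close>:
    \<open>1 / N\<close> for its length over the axis, \<open>M / N\<close> for its rise and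
    \<open>M / N\<close> for the clamping. The others give \<open>1 / N\<close> \<le> \<rho> and
    leave room for the clamping.\<close>
  obtain N :: nat where N: "(1 + 2 * M) / \<delta> + 1 / \<rho> + 2 * M + 1 < real N"
    using reals_Archimedean2 by blast
  have "0 \<le> (1 + 2 * M) / \<delta>" "0 < 1 / \<rho>" using M \<delta> \<rho> by simp_all
  with N M have N_bounds: "0 < real N" "(1 + 2 * M) / \<delta> < real N" "1 / \<rho> < real N" "2 * M < real N"
    by linarith+
  then have N_le: "(1 + 2 * M) / N < \<delta>" "1 / N \<le> \<rho>" "M / N \<le> 1 / 2"
    using \<delta> \<rho> by (simp_all add: field_simps)
  have K0_sub: "K0 \<subseteq> {0..1} \<times> {0..1}" "fst ` K0 = {0..1}" "compact K0"
    using K0 by (auto simp: CC_def)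
  have "\<exists>b. (real j / N, b) \<in> K0" if "j < N" for j
  proof -
    have "real j / N \<in> fst ` K0" using that K0_sub(2) by simp
    then show ?thesis by force
  qed
  then obtain \<beta> where \<beta>: "\<And>j. j < N \<Longrightarrow> (real j / N, \<beta> j) \<in> K0" by metis
  \<comment> \<open>The second coordinate is clamped so that the segments stay inside the unit square.\<close>
  define q where "q j = (real j / N, max (M / N) (min (1 - M / N) (\<beta> j)))" for j
  define seg where "seg j = (\<lambda>t. q j + t *\<^sub>R (1, s (q j))) ` {0..1 / N}" for j
  have clamp_bounds: "c \<le> max c (min (1 - c) b)" "max c (min (1 - c) b) \<le> 1 - c"
    "0 \<le> b \<Longrightarrow> b \<le> 1 \<Longrightarrow> \<bar>max c (min (1 - c) b) - b\<bar> \<le> c" if "0 \<le> c" "c \<le> 1 / 2" for b c :: real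
    using that by (auto simp: max_def min_def)
  have MN: "0 \<le> M / N" using M by simp
  have clamp: "\<bar>snd (q j) - \<beta> j\<bar> \<le> M / N" "M / N \<le> snd (q j)" "snd (q j) \<le> 1 - M / N" if "j < N" for j
    using \<beta>[OF that] K0_sub(1) clamp_bounds[OF MN N_le(3), of "\<beta> j"] by (auto simp: q_def)
  have q: "q j \<in> {0..1} \<times> {0..1}" if "j < N" for j
    using that clamp(2,3)[OF that] MN by (auto simp: q_def mem_Times_iff)
  have seg_height: "\<bar>t * s (q j)\<bar> \<le> M / N" if "j < N" "t \<in> {0..1 / N}" for j t
  proof -
    have "\<bar>t * s (q j)\<bar> \<le> (1 / N) * M"
      unfolding abs_mult using that s[OF q[OF that(1)]] by (intro mult_mono) auto
    then show ?thesis by simp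
  qed
  have seg_sq: "seg j \<subseteq> {0..1} \<times> {0..1}" if "j < N" for j
  proof -
    have "real j + 1 \<le> real N" using that by simp
    then have "real j / N + 1 / N \<le> 1" by (simp add: field_simps)
    then have "real j / N + t \<le> 1" if "t \<le> 1 / N" for t using that by linarith
    moreover have "0 \<le> snd (q j) + t * s (q j)" "snd (q j) + t * s (q j) \<le> 1" if "t \<in> {0..1 / N}" for t
      using clamp[OF \<open>j < N\<close>] seg_height[OF \<open>j < N\<close> that] by auto
    ultimately show ?thesis
      by (auto simp: seg_def q_def)
  qed
  obtain F where F: "F \<subseteq> K0" "finite F" "K0 \<subseteq> nbhd \<delta> F"
    unfolding nbhd_def
    by (rule compactE_image[OF K0_sub(3), of K0 "\<lambda>x. ball x \<delta>"]) (use \<delta> in auto)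
  define K where "K = F \<union> (\<Union>j<N. seg j)"
  have fst_seg: "fst ` seg j = {real j / N..real j / N + 1 / N}" for j
    by (simp add: seg_def q_def image_image)
  have "{0..1} \<subseteq> fst ` K"
  proof
    fix a :: real assume a: "a \<in> {0..1}"
    \<comment> \<open>The point \<open>1\<close> is the right end of the last segment; the floor
      used for the other points would give the index \<open>N\<close>.\<close>
    show "a \<in> fst ` K"
    proof (cases "a = 1")
      case True
      have "a \<in> fst ` seg (N - 1)" "N - 1 < N"
        using N_bounds(1) True unfolding fst_seg by (auto simp: field_simps of_nat_diff)
      then show ?thesis unfolding K_def by blast
    next
      case False
      define j where "j = nat \<lfloor>a * N\<rfloor>"
      have j: "real j \<le> a * N" "a * N < real j + 1" using a N_bounds(1) by (auto simp: j_def)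
      have "a * N < N" using False a N_bounds(1) by simp
      then have "j < N" using j(1) by linarith
      moreover have "a \<in> fst ` seg j"
        using j N_bounds(1) unfolding fst_seg by (auto simp: field_simps)
      ultimately show ?thesis unfolding K_def by blast
    qed
  qed
  moreover have K_sq: "K \<subseteq> {0..1} \<times> {0..1}"
    using F(1) K0_sub(1) seg_sq unfolding K_def by blast
  moreover have "compact K"
  proof -
    have "compact (seg j)" for j
      unfolding seg_def by (intro compact_continuous_image continuous_intros) auto
    then show ?thesis
      unfolding K_def using F(2) by (intro compact_Un compact_UN) (auto intro: finite_imp_compact)
  qed
  ultimately have K: "K \<in> CC" by (force simp: CC_def)
  have "K \<subseteq> nbhd \<delta> K0"
  proof -
    have "x \<in> nbhd \<delta> K0" if x: "x \<in> seg j" and j: "j < N" for x j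
    proof -
      obtain t where t: "t \<in> {0..1 / N}" "x = (real j / N + t, snd (q j) + t * s (q j))"
        using x by (auto simp: seg_def q_def)
      have "dist (real j / N, \<beta> j) x \<le> \<bar>t\<bar> + \<bar>\<beta> j - (snd (q j) + t * s (q j))\<bar>"
        using dist_real_pair_le[of "real j / N" "\<beta> j" "real j / N + t"] unfolding t(2) by simp
      also have "\<dots> \<le> 1 / N + M / N + M / N"
        using t(1) clamp(1)[OF j] seg_height[OF j t(1)] by auto
      also have "\<dots> < \<delta>" using N_le(1) by (simp add: add_divide_distrib)
      finally show ?thesis using \<beta>[OF j] by (auto simp: nbhd_def)
    qed
    then show ?thesis using F(1) subset_nbhd[OF \<delta>, of K0] unfolding K_def by blast
  qed
  moreover have "K0 \<subseteq> nbhd \<delta> K" using F(3) by (auto simp: K_def nbhd_def)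
  ultimately have "hausdorff_excess K K0 \<le> \<delta>" "hausdorff_excess K0 K \<le> \<delta>"
    using \<delta> by (auto intro: hausdorff_excess_le)
  then have close: "hausdorff_dist K K0 < \<epsilon>" using \<epsilon> by (auto simp: hausdorff_dist_def \<delta>_def)
  \<comment> \<open>With \<open>n\<close> exceeding the total number of pieces, the choice of
    \<open>r\<close> makes thickening all of them by \<open>r\<close> cost at most \<kappa>
    altogether.\<close>
  define n where "n = real N + real (card F) + 1"
  define r where "r = min \<rho> (\<kappa> / (2 * n * (C + 1)))"
  have n: "0 < n" by (simp add: n_def)
  have r: "0 < r" "r \<le> \<rho>" using \<rho> C n assms(1) by (simp_all add: r_def)
  have "r * (2 * n * (C + 1)) \<le> \<kappa>"
    using n C by (subst pos_le_divide_eq[symmetric]) (simp_all add: r_def)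
  moreover have "n * (2 * (C * r)) \<le> r * (2 * n * (C + 1))"
    using n r by (simp add: algebra_simps)
  ultimately have nCr: "n * (2 * (C * r)) \<le> \<kappa>" by linarith
  have "small_images P D \<phi> (3 * \<kappa>) K'" if K': "K' \<subseteq> nbhd r K" for K'
    unfolding small_images_def
  proof
    fix p assume p: "p \<in> P"
    \<comment> \<open>Half-width of the values over one segment: variation along it plus the effect
      of thickening.\<close>
    define w where "w = \<kappa> / N + C * r"
    define T1 where "T1 = (\<Union>x\<in>F. {v x p - C * r..v x p + C * r})"
    define T2 where "T2 = (\<Union>j\<in>{..<N}. {v (q j) p - w..v (q j) p + w})"
    have T1: "T1 \<in> lmeasurable" "measure lebesgue T1 \<le> card F * (2 * (C * r))"
      using finite_intervals_cover[OF F(2) _ order_refl, of "C * r" "\<lambda>x. v x p"] C r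
      by (simp_all add: T1_def)
    have T2: "T2 \<in> lmeasurable" "measure lebesgue T2 \<le> N * (2 * w)"
      using finite_intervals_cover[OF finite_lessThan _ order_refl, of w "\<lambda>j. v (q j) p" N] C r assms(1)
      by (simp_all add: T2_def w_def)
    have "measure lebesgue (T1 \<union> T2) \<le> card F * (2 * (C * r)) + N * (2 * w)"
      using measure_Un_le[of T1 lebesgue T2] T1 T2 by (auto simp: fmeasurableD)
    also have "\<dots> = 2 * \<kappa> + (real N + real (card F)) * (2 * (C * r))"
      using N_bounds(1) by (simp add: w_def field_simps)
    also have "\<dots> \<le> 2 * \<kappa> + n * (2 * (C * r))"
      using C r(1) by (intro add_left_mono mult_right_mono) (auto simp: n_def)
    also have "\<dots> \<le> 3 * \<kappa>" using nCr by simp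
    finally have "measure lebesgue (T1 \<union> T2) \<le> 3 * \<kappa>" .
    moreover have "\<phi> p ` (K' \<inter> D p) \<subseteq> T1 \<union> T2"
    proof
      fix y assume "y \<in> \<phi> p ` (K' \<inter> D p)"
      then obtain z where z: "z \<in> K'" "z \<in> D p" "y = \<phi> p z" by blast
      then obtain x where x: "x \<in> K" "dist x z < r" using K' by (auto simp: nbhd_def)
      consider "x \<in> F" | j where "j < N" "x \<in> seg j" using x(1) unfolding K_def by blast
      then show "y \<in> T1 \<union> T2"
      proof cases
        case 1
        have "x \<in> {0..1} \<times> {0..1}" using 1 F(1) K0_sub(1) by blast
        \<comment> \<open>A net point is treated as the start \<open>t = 0\<close> of a segment, so
          only the thickening contributes.\<close>
        then have "\<bar>y - v x p\<bar> \<le> \<kappa> * 0 + C * r"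
          unfolding z(3) by (rule v) (use p r \<rho> z x in \<open>auto simp flip: zero_prod_def\<close>)
        then have "y \<in> T1" unfolding T1_def using 1 by (intro UN_I[of x]) (auto simp: abs_le_iff)
        then show ?thesis by blast
      next
        case 2
        then obtain t where t: "t \<in> {0..1 / N}" "x = q j + t *\<^sub>R (1, s (q j))"
          by (auto simp: seg_def)
        have "\<bar>y - v (q j) p\<bar> \<le> \<kappa> * t + C * r"
          unfolding z(3) by (rule v[OF q[OF 2(1)] p]) (use r t N_le(2) z x in auto)
        moreover have "\<kappa> * t \<le> \<kappa> * (1 / N)" using t(1) assms(1) by (intro mult_left_mono) auto
        ultimately have "\<bar>y - v (q j) p\<bar> \<le> w" by (simp add: w_def)
        then have "y \<in> T2" unfolding T2_def using 2 by (intro UN_I[of j]) (auto simp: abs_le_iff)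
        then show ?thesis by blast
      qed
    qed
    moreover have "T1 \<union> T2 \<in> lmeasurable" using T1 T2 by (intro fmeasurable.Un)
    ultimately show "\<exists>T\<in>lmeasurable. \<phi> p ` (K' \<inter> D p) \<subseteq> T \<and> measure lebesgue T \<le> 3 * \<kappa>"
      by blast
  qed
  then show "\<exists>K\<in>CC. \<exists>r>0. hausdorff_dist K K0 < \<epsilon> \<and>
      (\<forall>K'\<in>CC. K' \<subseteq> nbhd r K \<longrightarrow> small_images P D \<phi> (3 * \<kappa>) K')"
    using K r(1) close by blast
qed

subsection \<open>Projections and slopes are tiltable\<close>

lemma dist_real_pairD:
  fixes a b c d :: real
  assumes "dist (a, b) (c, d) < r"
  shows "\<bar>a - c\<bar> < r" "\<bar>b - d\<bar> < r"
  using assms dist_fst_le[of "(a, b)" "(c, d)"] dist_snd_le[of "(a, b)" "(c, d)"]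
  by (simp_all add: dist_real_def)

text \<open>The direction \<open>(1, - x0)\<close> is the kernel direction of the projection with
  parameter \<open>x0\<close>; for a parameter \<open>x\<close> the speed along it is
  \<open>x - x0\<close>.\<close>

lemma tiltable_projections:
  assumes "0 < \<eta>"
  shows "tiltable {x0 - \<eta>..x0 + \<eta>} (\<lambda>_. UNIV) (\<lambda>x (a, b). a * x + b) \<eta>"
  unfolding tiltable_def
proof (intro exI conjI ballI)
  show "(0::real) < 1" "0 \<le> \<bar>x0\<bar> + \<eta> + 1" using assms by auto
  fix q :: "real \<times> real" assume "q \<in> {0..1} \<times> {0..1}"
  show "\<bar>- x0\<bar> \<le> \<bar>x0\<bar>" by simp
  fix x assume x: "x \<in> {x0 - \<eta>..x0 + \<eta>}"
  let ?a = "fst q" and ?b = "snd q"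
  have "\<bar>a' * x + b' - (?a * x + ?b)\<bar> \<le> \<eta> * t + (\<bar>x0\<bar> + \<eta> + 1) * r"
    if t: "0 \<le> t" and r: "0 \<le> r" and near: "dist (q + t *\<^sub>R (1, - x0)) (a', b') < r" for t r a' b'
  proof -
    have d: "\<bar>?a + t - a'\<bar> < r" "\<bar>?b - t * x0 - b'\<bar> < r"
      using dist_real_pairD[of "?a + t" "?b - t * x0" a' b' r] near by (cases q; simp)+
    have "a' * x + b' - (?a * x + ?b) = t * (x - x0) - (?a + t - a') * x - (?b - t * x0 - b')"
      by (simp add: algebra_simps)
    also have "\<bar>\<dots>\<bar> \<le> \<bar>t * (x - x0)\<bar> + \<bar>(?a + t - a') * x\<bar> + \<bar>?b - t * x0 - b'\<bar>" by linarith
    also have "\<dots> \<le> t * \<eta> + r * (\<bar>x0\<bar> + \<eta>) + r"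
      unfolding abs_mult using t d x r by (intro add_mono mult_mono) auto
    finally show ?thesis by (simp add: algebra_simps)
  qed
  then show "\<forall>t r q'. 0 \<le> t \<and> t \<le> 1 \<and> 0 \<le> r \<and> r \<le> 1 \<and> q' \<in> UNIV \<and> dist (q + t *\<^sub>R (1, - x0)) q' < r
      \<longrightarrow> \<bar>(case q' of (a, b) \<Rightarrow> a * x + b) - (?a * x + ?b)\<bar> \<le> \<eta> * t + (\<bar>x0\<bar> + \<eta> + 1) * r"
    by auto
qed

definition slope :: "real \<times> real \<Rightarrow> real \<times> real \<Rightarrow> real" where
  "slope p q = (snd q - snd p) / (fst q - fst p)"

text \<open>The points at which the denominator of \<open>slope p\<close> stays at least
  \<open>h\<close> in absolute value.\<close>

definition far_strip :: "real \<Rightarrow> real \<times> real \<Rightarrow> (real \<times> real) set" where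
  "far_strip h p = {q. h \<le> \<bar>fst q - fst p\<bar>}"

text \<open>Here \<open>(u, w)\<close> is the base point seen from the centre. The factor
  \<open>s * u - w\<close> vanishes exactly when the segment points at the centre.\<close>

lemma slope_tilted_diff:
  fixes u \<delta> s t :: real
  assumes "u \<noteq> 0" "u + t \<noteq> 0"
  shows "(w + t * s) / (u + t) - w / u = t * (s * u - w) / ((u + t) * u)"
  using assms by (simp add: field_simps)

lemma quotient_perturbation:
  fixes u u' w w' :: real
  assumes "u \<noteq> 0" "u' \<noteq> 0"
  shows "w' / u' - w / u = (w' - w) / u' + w * (u - u') / (u' * u)"
  using assms by (simp add: field_simps)

text \<open>Base points whose vertical strip is close to \<open>p0\<close> impose no condition; elsewhere the segment
  is directed towards \<open>p0\<close>.\<close>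

lemma tiltable_slopes:
  assumes h: "0 < h" and \<eta>: "0 < \<eta>" "\<eta> \<le> h / 8"
    and \<kappa>: "\<kappa> = 16 * ((1 + \<bar>snd p0\<bar>) * 2 / h + 1) * \<eta> / h\<^sup>2"
  shows "tiltable ({fst p0 - \<eta>..fst p0 + \<eta>} \<times> {snd p0 - \<eta>..snd p0 + \<eta>}) (far_strip h) slope \<kappa>"
proof -
  obtain c0 d0 where p0: "p0 = (c0, d0)" by (cases p0)
  \<comment> \<open>\<open>M\<close> bounds the tilt \<open>s\<close>, since the base point is at
    horizontal distance at least \<open>h / 2\<close> from \<open>p0\<close> whenever a tilt is
    needed. \<open>W\<close> bounds the numerators of the slopes, and \<open>C\<close> collects the
    error of a displacement by \<open>r\<close>.\<close>
  define M where "M = (1 + \<bar>d0\<bar>) * 2 / h"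
  define W where "W = 1 + M * h + \<bar>d0\<bar> + \<eta>"
  define C where "C = 1 / h + W / (h * (h / 4))"
  have M: "0 \<le> M" using h by (simp add: M_def)
  have W: "0 \<le> W" using M h \<eta> by (simp add: W_def)
  have C: "0 \<le> C" using W h by (simp add: C_def)
  have "\<exists>s. \<bar>s\<bar> \<le> M \<and> (\<forall>p\<in>{c0 - \<eta>..c0 + \<eta>} \<times> {d0 - \<eta>..d0 + \<eta>}. \<exists>v. \<forall>t r q'. 0 \<le> t \<and> t \<le> h / 8 \<and>
      0 \<le> r \<and> r \<le> h / 8 \<and> q' \<in> far_strip h p \<and> dist ((a, b) + t *\<^sub>R (1, s)) q' < r
        \<longrightarrow> \<bar>slope p q' - v\<bar> \<le> \<kappa> * t + C * r)"
    if ab: "a \<in> {0..1}" "b \<in> {0..1}" for a b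
  proof (cases "\<bar>a - c0\<bar> < h / 2")
    case True
    \<comment> \<open>The horizontal distance from \<open>p\<close> to \<open>q'\<close> is less
      than \<open>h / 2 + 3 * (h / 8)\<close>, hence less than \<open>h\<close>.\<close>
    have "False" if "p \<in> {c0 - \<eta>..c0 + \<eta>} \<times> {d0 - \<eta>..d0 + \<eta>}" "0 \<le> t" "t \<le> h / 8" "r \<le> h / 8"
      "q' \<in> far_strip h p" "dist ((a, b) + t *\<^sub>R (1, 0)) q' < r" for p t r q'
    proof -
      have "\<bar>a + t - fst q'\<bar> < r"
        using dist_real_pairD(1)[of "a + t" b "fst q'" "snd q'" r] that(6) by simp
      moreover have "\<bar>fst p - c0\<bar> \<le> \<eta>" "h \<le> \<bar>fst q' - fst p\<bar>" using that(1,5) by (auto simp: far_strip_def)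
      ultimately show False using True that(2-4) \<eta> by linarith
    qed
    then show ?thesis using M by (intro exI[of _ 0] conjI) (simp, blast)
  next
    case False
    define s where "s = (b - d0) / (a - c0)"
    have s: "s * (a - c0) = b - d0" using False h by (auto simp: s_def)
    have "\<bar>s\<bar> \<le> (1 + \<bar>d0\<bar>) / (h / 2)"
      unfolding s_def abs_divide using ab False h by (intro frac_le) auto
    then have s_le: "\<bar>s\<bar> \<le> M" using h by (simp add: M_def field_simps)
    have "\<bar>slope (c, d) (a', b') - (b - d) / (a - c)\<bar> \<le> \<kappa> * t + C * r"
      if p: "\<bar>c - c0\<bar> \<le> \<eta>" "\<bar>d - d0\<bar> \<le> \<eta>" and t: "0 \<le> t" "t \<le> h / 8" and r: "0 \<le> r" "r \<le> h / 8"
        and far: "h \<le> \<bar>a' - c\<bar>" and near: "dist ((a, b) + t *\<^sub>R (1, s)) (a', b') < r"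
      for c d t r a' b'
    proof -
      have d: "\<bar>a + t - a'\<bar> < r" "\<bar>b + t * s - b'\<bar> < r"
        using dist_real_pairD[of "a + t" "b + t * s" a' b' r] near by simp_all
      have low: "h / 4 \<le> \<bar>a - c\<bar>" "h / 4 \<le> \<bar>a - c + t\<bar>" using False p t \<eta> by linarith+
      then have nz: "a - c \<noteq> 0" "a - c + t \<noteq> 0" "a' - c \<noteq> 0" using h far by auto
      \<comment> \<open>The numerator vanishes for the centre \<open>p0\<close>, so only the
        deviation of \<open>(c, d)\<close> from \<open>p0\<close> remains, which is of order
        \<eta>.\<close>
      have "s * (a - c) - (b - d) = s * (c0 - c) + (d - d0)" using s by (simp add: algebra_simps)
      also have "\<bar>\<dots>\<bar> \<le> \<bar>s * (c0 - c)\<bar> + \<bar>d - d0\<bar>" by linarith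
      also have "\<dots> \<le> M * \<eta> + \<eta>"
        unfolding abs_mult using s_le p M by (intro add_mono mult_mono) auto
      finally have num: "\<bar>s * (a - c) - (b - d)\<bar> \<le> (M + 1) * \<eta>" by (simp add: algebra_simps)
      have "\<bar>(b - d + t * s) / (a - c + t) - (b - d) / (a - c)\<bar>
          = t * \<bar>s * (a - c) - (b - d)\<bar> / (\<bar>a - c + t\<bar> * \<bar>a - c\<bar>)"
        unfolding slope_tilted_diff[OF nz(1,2)] using t by (simp add: abs_mult)
      \<comment> \<open>Both denominators are at least \<open>h / 4\<close>, whence the factor 16
        over the square of \<open>h\<close> in \<kappa>.\<close>
      also have "\<dots> \<le> t * ((M + 1) * \<eta>) / ((h / 4) * (h / 4))"
        using num low t h M \<eta> by (intro frac_le mult_mono mult_nonneg_nonneg) auto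
      also have "\<dots> = \<kappa> * t" unfolding \<kappa> p0 M_def by (simp add: power2_eq_square)
      finally have along: "\<bar>(b - d + t * s) / (a - c + t) - (b - d) / (a - c)\<bar> \<le> \<kappa> * t" .
      have "\<bar>t * s\<bar> \<le> h * M" unfolding abs_mult using t s_le h by (intro mult_mono) auto
      then have W_le: "\<bar>b - d + t * s\<bar> \<le> W" using ab p by (auto simp: W_def mult.commute)
      have "\<bar>(b' - d) / (a' - c) - (b - d + t * s) / (a - c + t)\<bar>
          \<le> \<bar>(b' - d - (b - d + t * s)) / (a' - c)\<bar>
            + \<bar>(b - d + t * s) * (a - c + t - (a' - c)) / ((a' - c) * (a - c + t))\<bar>"
        unfolding quotient_perturbation[OF nz(2,3)] by (rule abs_triangle_ineq)
      also have "\<dots> \<le> r / h + W * r / (h * (h / 4))"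
        unfolding abs_divide abs_mult using d far low W_le W h r
        by (intro add_mono frac_le mult_mono mult_nonneg_nonneg) auto
      also have "\<dots> = C * r" by (simp add: C_def algebra_simps)
      finally have across: "\<bar>(b' - d) / (a' - c) - (b - d + t * s) / (a - c + t)\<bar> \<le> C * r" .
      have "\<bar>x - z\<bar> \<le> B + A" if "\<bar>y - z\<bar> \<le> B" "\<bar>x - y\<bar> \<le> A" for x y z A B :: real
        using that by linarith
      from this[OF along across] show ?thesis by (simp add: slope_def)
    qed
    then have "\<forall>t r q'. 0 \<le> t \<and> t \<le> h / 8 \<and> 0 \<le> r \<and> r \<le> h / 8 \<and> q' \<in> far_strip h p \<and>
        dist ((a, b) + t *\<^sub>R (1, s)) q' < r \<longrightarrow> \<bar>slope p q' - (b - snd p) / (a - fst p)\<bar> \<le> \<kappa> * t + C * r"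
      if "p \<in> {c0 - \<eta>..c0 + \<eta>} \<times> {d0 - \<eta>..d0 + \<eta>}" for p
      using that by (auto simp: far_strip_def abs_le_iff)
    then show ?thesis using s_le by blast
  qed
  moreover have "0 < h / 8" using h by simp
  ultimately show ?thesis
    unfolding tiltable_def p0 using C by (intro exI[of _ M] exI[of _ C] exI[of _ "h / 8"]) auto
qed

subsection \<open>Thin sets\<close>

text \<open>Points on the vertical through \<open>p\<close> are left out of the slopes: they are
  dual to lines parallel or equal to the dual line of \<open>p\<close>.\<close>

definition thin :: "(real \<times> real) set \<Rightarrow> bool" where
  "thin K \<longleftrightarrow>
     (\<forall>x. negligible ((\<lambda>(a, b). a * x + b) ` K)) \<and>
     (\<forall>p. negligible (slope p ` {q \<in> K. fst q \<noteq> fst p}))"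

definition projection_condition :: "real \<times> real \<Rightarrow> (real \<times> real) set \<Rightarrow> bool" where
  "projection_condition = (\<lambda>(x0, \<eta>).
     small_images {x0 - \<eta>..x0 + \<eta>} (\<lambda>_. UNIV) (\<lambda>x (a, b). a * x + b) (3 * \<eta>))"

definition slope_condition :: "(real \<times> real) \<times> real \<times> real \<Rightarrow> (real \<times> real) set \<Rightarrow> bool" where
  "slope_condition = (\<lambda>(p0, h, \<eta>).
     small_images ({fst p0 - \<eta>..fst p0 + \<eta>} \<times> {snd p0 - \<eta>..snd p0 + \<eta>}) (far_strip h) slope
       (3 * (16 * ((1 + \<bar>snd p0\<bar>) * 2 / h + 1) * \<eta> / h\<^sup>2)))"

text \<open>Rational parameters keep the family countable while their boxes still reach every centre
  with arbitrarily small \<eta>. The constraint \<eta> \<le> \<open>h / 8\<close> is what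
  \<open>tiltable_slopes\<close> requires.\<close>

definition thinness_conditions :: "((real \<times> real) set \<Rightarrow> bool) set" where
  "thinness_conditions =
     projection_condition ` (\<rat> \<times> {\<eta> \<in> \<rat>. 0 < \<eta>}) \<union>
     slope_condition ` ((\<rat> \<times> \<rat>) \<times> {(h, \<eta>). h \<in> \<rat> \<and> \<eta> \<in> \<rat> \<and> 0 < h \<and> 0 < \<eta> \<and> \<eta> \<le> h / 8})"

lemma countable_thinness_conditions: "countable thinness_conditions"
proof -
  have "countable {(h::real, \<eta>::real). h \<in> \<rat> \<and> \<eta> \<in> \<rat> \<and> 0 < h \<and> 0 < \<eta> \<and> \<eta> \<le> h / 8}"
    by (rule countable_subset[of _ "\<rat> \<times> \<rat>"]) (auto simp: countable_rat)
  moreover have "countable {\<eta>::real. \<eta> \<in> \<rat> \<and> 0 < \<eta>}"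
    by (rule countable_subset[of _ "\<rat>"]) (auto simp: countable_rat)
  ultimately show ?thesis
    unfolding thinness_conditions_def
    by (intro countable_Un countable_image countable_SIGMA countable_rat)
qed

lemma robustly_dense_thinness_conditions:
  assumes "Q \<in> thinness_conditions"
  shows "robustly_dense Q"
  using assms unfolding thinness_conditions_def
proof
  assume "Q \<in> projection_condition ` (\<rat> \<times> {\<eta> \<in> \<rat>. 0 < \<eta>})"
  then obtain x0 \<eta> where "0 < \<eta>" "Q = projection_condition (x0, \<eta>)" by auto
  then show ?thesis
    by (simp add: projection_condition_def robustly_dense_small_images tiltable_projections)
next
  assume "Q \<in> slope_condition ` ((\<rat> \<times> \<rat>) \<times> {(h, \<eta>). h \<in> \<rat> \<and> \<eta> \<in> \<rat> \<and> 0 < h \<and> 0 < \<eta> \<and> \<eta> \<le> h / 8})"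
  then obtain p0 h \<eta> where *: "0 < h" "0 < \<eta>" "\<eta> \<le> h / 8" and Q: "Q = slope_condition (p0, h, \<eta>)" by auto
  have "0 < 16 * ((1 + \<bar>snd p0\<bar>) * 2 / h + 1) * \<eta> / h\<^sup>2"
    using * by (intro divide_pos_pos mult_pos_pos add_nonneg_pos) auto
  with Q show ?thesis
    using robustly_dense_small_images[OF _ tiltable_slopes[OF * refl, of p0]]
    by (simp add: slope_condition_def)
qed

text \<open>For every small rational \<eta>, the number \<open>x\<close> lies in the window of some
  rational \<open>x0\<close>, so the projection has a cover of measure at most \<open>3 *\<close>
  \<eta>.\<close>

lemma negligible_if_projection_conditions:
  assumes "\<forall>Q\<in>thinness_conditions. Q K"
  shows "negligible ((\<lambda>(a, b). a * x + b) ` K)"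
  unfolding negligible_outer_le
proof (intro allI impI)
  fix e :: real assume "0 < e"
  then obtain \<eta> where \<eta>: "\<eta> \<in> \<rat>" "0 < \<eta>" "\<eta> < e / 3"
    using Rats_dense_in_real[of 0 "e / 3"] by auto
  obtain x0 where x0: "x0 \<in> \<rat>" "x - \<eta> < x0" "x0 < x"
    using Rats_dense_in_real[of "x - \<eta>" x] \<eta> by auto
  have "projection_condition (x0, \<eta>) \<in> thinness_conditions"
    using \<eta> x0 unfolding thinness_conditions_def by blast
  then have "small_images {x0 - \<eta>..x0 + \<eta>} (\<lambda>_. UNIV) (\<lambda>x (a, b). a * x + b) (3 * \<eta>) K"
    using assms by (fastforce simp: projection_condition_def)
  then have "\<exists>T\<in>lmeasurable. (\<lambda>(a, b). a * x + b) ` (K \<inter> UNIV) \<subseteq> T \<and> measure lebesgue T \<le> 3 * \<eta>"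
    unfolding small_images_def by (rule bspec) (use x0 \<eta> in simp)
  then obtain T where "T \<in> lmeasurable" "(\<lambda>(a, b). a * x + b) ` K \<subseteq> T" "measure lebesgue T \<le> 3 * \<eta>"
    by auto
  then show "\<exists>T. (\<lambda>(a, b). a * x + b) ` K \<subseteq> T \<and> T \<in> lmeasurable \<and> measure lebesgue T \<le> e"
    using \<eta>(3) by (intro exI[of _ T]) auto
qed

lemma negligible_if_slope_conditions:
  assumes "\<forall>Q\<in>thinness_conditions. Q K" and h: "h \<in> \<rat>" "0 < h"
  shows "negligible (slope p ` (K \<inter> far_strip h p))"
  unfolding negligible_outer_le
proof (intro allI impI)
  fix e :: real assume e: "0 < e"
  \<comment> \<open>The bound for a centre depends on \<open>d0\<close>, which is picked only after
    \<eta>. As \<open>d0\<close> is within 1 of \<open>snd p\<close>, replacing 1 by 2 gives a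
    constant fixed in advance.\<close>
  define A where "A = 3 * (16 * ((2 + \<bar>snd p\<bar>) * 2 / h + 1) / h\<^sup>2)"
  have A: "0 < A"
    unfolding A_def using h by (intro mult_pos_pos divide_pos_pos add_nonneg_pos) auto
  obtain \<eta> where \<eta>: "\<eta> \<in> \<rat>" "0 < \<eta>" "\<eta> < min (h / 8) (min 1 (e / A))"
    using Rats_dense_in_real[of 0 "min (h / 8) (min 1 (e / A))"] h e A by auto
  obtain c0 d0 where c0: "c0 \<in> \<rat>" "fst p - \<eta> < c0" "c0 < fst p"
    and d0: "d0 \<in> \<rat>" "snd p - \<eta> < d0" "d0 < snd p"
    using Rats_dense_in_real[of "fst p - \<eta>" "fst p"] Rats_dense_in_real[of "snd p - \<eta>" "snd p"] \<eta> by auto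
  define \<kappa> where "\<kappa> = 3 * (16 * ((1 + \<bar>d0\<bar>) * 2 / h + 1) * \<eta> / h\<^sup>2)"
  have "slope_condition ((c0, d0), h, \<eta>) \<in> thinness_conditions"
    using \<eta> c0 d0 h unfolding thinness_conditions_def by (intro UnI2 imageI) auto
  then have "slope_condition ((c0, d0), h, \<eta>) K" using assms(1) by blast
  then have "small_images ({c0 - \<eta>..c0 + \<eta>} \<times> {d0 - \<eta>..d0 + \<eta>}) (far_strip h) slope \<kappa> K"
    by (simp add: slope_condition_def \<kappa>_def)
  moreover have "p \<in> {c0 - \<eta>..c0 + \<eta>} \<times> {d0 - \<eta>..d0 + \<eta>}" using c0 d0 \<eta> by (simp add: mem_Times_iff)
  ultimately obtain T where T: "T \<in> lmeasurable" "slope p ` (K \<inter> far_strip h p) \<subseteq> T" "measure lebesgue T \<le> \<kappa>"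
    unfolding small_images_def by blast
  have "\<kappa> \<le> 3 * (16 * ((2 + \<bar>snd p\<bar>) * 2 / h + 1) * \<eta> / h\<^sup>2)"
    unfolding \<kappa>_def using h \<eta> d0
    by (intro mult_left_mono divide_right_mono mult_right_mono add_right_mono) auto
  also have "\<dots> = A * \<eta>" by (simp add: A_def)
  also have "\<dots> \<le> e" using \<eta>(3) A by (simp add: field_simps)
  finally show "\<exists>T. slope p ` (K \<inter> far_strip h p) \<subseteq> T \<and> T \<in> lmeasurable \<and> measure lebesgue T \<le> e"
    using T by (intro exI[of _ T]) auto
qed

text \<open>The points off the vertical through \<open>p\<close> are exhausted by countably many
  strips of rational distance \<open>1 / (n + 1)\<close>.\<close>

lemma thin_if_conditions:
  assumes "\<forall>Q\<in>thinness_conditions. Q K"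
  shows "thin K"
  unfolding thin_def
proof (intro conjI allI)
  fix p :: "real \<times> real"
  have "slope p ` {q \<in> K. fst q \<noteq> fst p} \<subseteq> (\<Union>n::nat. slope p ` (K \<inter> far_strip (1 / real (Suc n)) p))"
  proof
    fix y assume "y \<in> slope p ` {q \<in> K. fst q \<noteq> fst p}"
    then obtain q where q: "q \<in> K" "fst q \<noteq> fst p" "y = slope p q" by blast
    then obtain n where "1 / real (Suc n) < \<bar>fst q - fst p\<bar>"
      using reals_Archimedean[of "\<bar>fst q - fst p\<bar>"] by (auto simp: inverse_eq_divide)
    with q show "y \<in> (\<Union>n::nat. slope p ` (K \<inter> far_strip (1 / real (Suc n)) p))"
      by (intro UN_I[of n]) (auto simp: far_strip_def)
  qed
  moreover have "negligible (slope p ` (K \<inter> far_strip (1 / real (Suc n)) p))" for n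
    using negligible_if_slope_conditions[OF assms] by simp
  then have "negligible (\<Union>n::nat. slope p ` (K \<inter> far_strip (1 / real (Suc n)) p))"
    by (intro negligible_countable_Union countable_image) auto
  ultimately show "negligible (slope p ` {q \<in> K. fst q \<noteq> fst p})"
    by (rule negligible_subset[rotated])
qed (rule negligible_if_projection_conditions[OF assms])

lemma ex_thin: "\<exists>K\<in>CC. thin K"
proof -
  have ne: "thinness_conditions \<noteq> {}"
    unfolding thinness_conditions_def by (auto intro!: exI[of _ 1])
  define f where "f = from_nat_into thinness_conditions"
  have range_f: "range f = thinness_conditions"
    unfolding f_def by (rule range_from_nat_into[OF ne countable_thinness_conditions])
  have "robustly_dense (f n)" for n
    using robustly_dense_thinness_conditions range_f by blast
  then obtain K where K: "K \<in> CC" "\<forall>n. f n K"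
    using robustly_dense_nonempty by blast
  then have "\<forall>Q\<in>thinness_conditions. Q K" unfolding range_f[symmetric] by blast
  then show ?thesis using thin_if_conditions K(1) by blast
qed

subsection \<open>The dual of a thin set and its rotations\<close>

lemma negligible_affine_preimage:
  fixes A :: "real set"
  assumes "negligible A" "\<beta> \<noteq> 0"
  shows "negligible {t. \<alpha> + \<beta> * t \<in> A}"
proof -
  have "{t. \<alpha> + \<beta> * t \<in> A} = (\<lambda>x. (x - \<alpha>) / \<beta>) ` A"
    using assms(2) by (force simp: field_simps image_iff)
  then show ?thesis
    by (simp, intro negligible_differentiable_image_negligible)
       (use assms in \<open>auto simp: differentiable_on_def intro!: derivative_intros\<close>)
qed

lemma l_eq_line: "l a b = line (0, b) (1, a)"
  by (auto simp: l_def line_def algebra_simps)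

lemma line_eq_l:
  assumes "v1 \<noteq> 0"
  shows "line (p1, p2) (v1, v2) = l (v2 / v1) (p2 - v2 / v1 * p1)"
proof -
  have "(x, y) \<in> line (p1, p2) (v1, v2) \<longleftrightarrow> y = v2 / v1 * x + (p2 - v2 / v1 * p1)" for x y
  proof
    assume "(x, y) \<in> line (p1, p2) (v1, v2)"
    then obtain t where "x = p1 + t * v1" "y = p2 + t * v2" by (auto simp: line_def)
    then show "y = v2 / v1 * x + (p2 - v2 / v1 * p1)" using assms by (simp add: field_simps)
  next
    assume "y = v2 / v1 * x + (p2 - v2 / v1 * p1)"
    then have "(x, y) = (p1, p2) + ((x - p1) / v1) *\<^sub>R (v1, v2)" using assms by (simp add: field_simps)
    then show "(x, y) \<in> line (p1, p2) (v1, v2)" unfolding line_def by blast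
  qed
  then show ?thesis by (auto simp: l_def)
qed

text \<open>On a vertical line the ordinates met form a projection of \<open>K\<close>. On
  \<open>l c d\<close> the crossing with \<open>l a b\<close> has abscissa
  \<open>- slope (c, d) (a, b)\<close>. Either way the parameter \<open>t\<close> depends affinely
  on a point of a null set.\<close>

lemma thin_dual_meets_line:
  assumes "thin K" "v \<noteq> 0"
  shows "negligible {t. p + t *\<^sub>R v \<in> \<Union>(dual K - {line p v})}"
proof -
  obtain p1 p2 v1 v2 where pv: "p = (p1, p2)" "v = (v1, v2)" by (cases p, cases v)
  show ?thesis
  proof (cases "v1 = 0")
    case True
    then have "v2 \<noteq> 0" using assms(2) pv by (auto simp: zero_prod_def)
    moreover have "negligible ((\<lambda>(a, b). a * p1 + b) ` K)" using assms(1) by (simp add: thin_def)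
    ultimately have "negligible {t. p2 + v2 * t \<in> (\<lambda>(a, b). a * p1 + b) ` K}"
      by (intro negligible_affine_preimage)
    then show ?thesis
      by (rule negligible_subset) (auto simp: dual_def l_def pv True mult.commute image_iff)
  next
    case False
    define c d where "c = v2 / v1" and "d = p2 - c * p1"
    have e: "line p v = l c d" unfolding pv c_def d_def by (rule line_eq_l[OF False])
    have "negligible (slope (c, d) ` {q \<in> K. fst q \<noteq> fst (c, d)})"
      using assms(1) unfolding thin_def by blast
    then have "negligible {t. - p1 + (- v1) * t \<in> slope (c, d) ` {q \<in> K. fst q \<noteq> fst (c, d)}}"
      using False by (intro negligible_affine_preimage) auto
    then show ?thesis
    proof (rule negligible_subset, intro subsetI, unfold mem_Collect_eq)
      fix t assume "p + t *\<^sub>R v \<in> \<Union> (dual K - {line p v})"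
      then obtain a b where ab: "(a, b) \<in> K" "p + t *\<^sub>R v \<in> l a b" "l a b \<noteq> l c d"
        unfolding e dual_def by blast
      have "v2 = c * v1" using False by (simp add: c_def)
      then have eq: "d - b = (a - c) * (p1 + t * v1)"
        using ab(2) by (simp add: pv l_def d_def algebra_simps)
      \<comment> \<open>Equal slopes and a common point would make the two lines coincide.\<close>
      then have "a \<noteq> c" using ab(3) by auto
      then have "- p1 + (- v1) * t = slope (c, d) (a, b)"
        using eq by (simp add: slope_def field_simps)
      then show "- p1 + (- v1) * t \<in> slope (c, d) ` {q \<in> K. fst q \<noteq> fst (c, d)}"
        using ab(1) \<open>a \<noteq> c\<close> by force
    qed
  qed
qed

lemma mem_Union_dual: "(x, y) \<in> \<Union>(dual K) \<longleftrightarrow> (\<exists>q\<in>K. y = fst q * x + snd q)"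
proof
  assume "(x, y) \<in> \<Union>(dual K)"
  then obtain a b where "(a, b) \<in> K" "y = a * x + b" by (auto simp: dual_def l_def)
  then show "\<exists>q\<in>K. y = fst q * x + snd q" by (intro bexI[of _ "(a, b)"]) auto
next
  assume "\<exists>q\<in>K. y = fst q * x + snd q"
  then obtain a b where "(a, b) \<in> K" "(x, y) \<in> l a b" by (auto simp: l_def)
  then show "(x, y) \<in> \<Union>(dual K)" unfolding dual_def by blast
qed

section \<open>Closedness and measure of the union of the dual\<close>

text \<open>The union is the image of the closed incidence relation under the projection along the
  compact factor \<open>K\<close>, which is a closed map.\<close>

lemma closed_Union_dual:
  assumes "compact K"
  shows "closed (\<Union>(dual K))"
proof -
  define G where "G = (UNIV \<times> K) \<inter> {w :: (real \<times> real) \<times> real \<times> real.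
    snd (fst w) = fst (snd w) * fst (fst w) + snd (snd w)}"
  have "closed G"
    unfolding G_def using assms
    by (intro closed_Int closed_Times closed_Collect_eq continuous_intros compact_imp_closed) auto
  then have "closedin (top_of_set (UNIV \<times> K)) G"
    by (intro closed_subset) (auto simp: G_def)
  then have "closed (fst ` G)"
    using Starlike.closed_map_fst[OF assms, of UNIV G] by simp
  moreover have "z \<in> \<Union>(dual K) \<longleftrightarrow> z \<in> fst ` G" for z
    using mem_Union_dual[of "fst z" "snd z" K] by (force simp: G_def image_iff)
  then have "\<Union>(dual K) = fst ` G" by blast
  ultimately show ?thesis by simp
qed

text \<open>Tonelli's theorem; closedness supplies the Borel measurability of the set and of its
  sections.\<close>

lemma negligible_if_closed_sections:
  fixes S :: "(real \<times> real) set"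
  assumes "closed S" and sections: "\<And>x. negligible {y. (x, y) \<in> S}"
  shows "negligible S"
proof -
  have S: "S \<in> sets (lborel \<Otimes>\<^sub>M lborel)"
    unfolding lborel_prod using borel_closed[OF assms(1)] by simp
  have "emeasure lborel (Pair x -` S) = 0" for x
  proof -
    have "closed (Pair x -` S)" by (intro closed_vimage assms(1) continuous_intros)
    then have "Pair x -` S \<in> sets lborel" using borel_closed by simp
    then show ?thesis
      using sections[of x] by (auto simp: negligible_iff_emeasure0 vimage_def)
  qed
  then have "emeasure (lborel \<Otimes>\<^sub>M lborel) S = 0"
    unfolding lborel.emeasure_pair_measure_alt[OF S] by simp
  then have "S \<in> null_sets (lborel \<Otimes>\<^sub>M lborel)" using S by (intro null_setsI)
  then have "S \<in> null_sets lborel" unfolding lborel_prod .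
  then show ?thesis by (simp add: negligible_iff_null_sets null_sets_completionI)
qed

text \<open>The vertical sections are the projections of \<open>K\<close>, which are null by
  thinness.\<close>

lemma negligible_Union_dual:
  assumes "compact K" "thin K"
  shows "negligible (\<Union>(dual K))"
proof (rule negligible_if_closed_sections[OF closed_Union_dual[OF assms(1)]])
  fix x
  have "{y. (x, y) \<in> \<Union>(dual K)} = (\<lambda>(a, b). a * x + b) ` K"
    unfolding mem_Union_dual by (auto simp: case_prod_beta)
  then show "negligible {y. (x, y) \<in> \<Union>(dual K)}" using assms(2) by (simp add: thin_def)
qed

section \<open>Rotations and directions\<close>

lemma linear_rot: "linear (rot \<theta>)"
  by (rule linearI) (auto simp: rot_def algebra_simps split: prod.splits)

lemma rot_rot: "rot \<alpha> (rot \<beta> z) = rot (\<alpha> + \<beta>) z"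
  by (simp add: rot_def cos_add sin_add algebra_simps split: prod.splits)

lemma rot_minus_cancel [simp]: "rot (- \<theta>) (rot \<theta> z) = z" "rot \<theta> (rot (- \<theta>) z) = z"
  unfolding rot_rot by (simp_all add: rot_def split: prod.splits)

lemma rot_line: "rot \<theta> ` line p v = line (rot \<theta> p) (rot \<theta> v)"
  by (simp add: line_def image_image linear_add[OF linear_rot] linear_cmul[OF linear_rot])

lemma rot_eq_0_iff [simp]: "rot \<theta> v = 0 \<longleftrightarrow> v = 0"
  using rot_minus_cancel(1)[of \<theta> v] linear_0[OF linear_rot] by metis

lemma closed_rot_image:
  assumes "closed S"
  shows "closed (rot \<theta> ` S)"
proof -
  have "rot \<theta> ` S = rot (- \<theta>) -` S"
  proof (intro equalityI subsetI)
    fix x assume "x \<in> rot (- \<theta>) -` S"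
    then show "x \<in> rot \<theta> ` S" by (intro image_eqI[of _ _ "rot (- \<theta>) x"]) simp_all
  qed (metis imageE rot_minus_cancel(1) vimageI)
  then show ?thesis
    by (simp add: closed_vimage assms linear_continuous_on linear_conv_bounded_linear[THEN iffD1, OF linear_rot])
qed

lemma negligible_rot_image: "negligible S \<Longrightarrow> negligible (rot \<theta> ` S)"
  by (rule negligible_differentiable_image_negligible)
     (auto intro: linear_imp_differentiable_on linear_rot)

lemma finite_four_angles: "finite four_angles"
  by (simp add: four_angles_def)

lemma Union_four_rotations: "\<Union>(four_rotations L') = (\<Union>\<theta>\<in>four_angles. rot \<theta> ` \<Union>L')"
  by (auto simp: four_rotations_def)

lemma is_line_four_rotations_dual:
  assumes "e \<in> four_rotations (dual K)"
  shows "is_line e"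
proof -
  obtain \<theta> a b where "e = rot \<theta> ` l a b" using assms by (auto simp: four_rotations_def dual_def)
  then have "e = line (rot \<theta> (0, b)) (rot \<theta> (1, a))" by (simp add: l_eq_line rot_line)
  moreover have "rot \<theta> (1, a) \<noteq> 0" unfolding rot_eq_0_iff by (simp add: zero_prod_def)
  ultimately show ?thesis unfolding is_line_def by blast
qed

text \<open>Slopes in \<open>{0..1}\<close> fill the angles from 0 to \<pi>\<open>/ 4\<close>. The
  four rotations extend this to a half turn, and negative \<open>k\<close> covers the opposite
  directions.\<close>

lemma four_angles_directions:
  assumes "v \<noteq> 0"
  obtains \<theta> k a where "\<theta> \<in> four_angles" "a \<in> {0..1}" "v = k *\<^sub>R rot \<theta> (1, a)"
proof -
  note found = that
  \<comment> \<open>The inequalities say that \<open>v\<close>, rotated back, lies in the double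
    sector of slopes between 0 and 1.\<close>
  have *: thesis if \<theta>: "\<theta> \<in> four_angles" and u: "rot (- \<theta>) v = (u1, u2)" and "0 \<le> u1 * u2" "\<bar>u2\<bar> \<le> \<bar>u1\<bar>"
    for \<theta> u1 u2
  proof -
    have "u1 \<noteq> 0"
    proof
      assume "u1 = 0"
      then have "rot (- \<theta>) v = 0" using u \<open>\<bar>u2\<bar> \<le> \<bar>u1\<bar>\<close> by (simp add: zero_prod_def)
      then show False using assms by simp
    qed
    moreover have "0 \<le> u2 / u1" using \<open>0 \<le> u1 * u2\<close> by (simp add: zero_le_divide_iff zero_le_mult_iff) argo
    moreover have "\<bar>u2 / u1\<bar> \<le> 1"
      unfolding abs_divide using \<open>\<bar>u2\<bar> \<le> \<bar>u1\<bar>\<close> \<open>u1 \<noteq> 0\<close> by (simp add: divide_le_eq_1)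
    then have "u2 / u1 \<le> 1" by (rule abs_le_D1)
    ultimately have "u2 / u1 \<in> {0..1}" "rot (- \<theta>) v = u1 *\<^sub>R (1, u2 / u1)" by (auto simp: u)
    then have "v = u1 *\<^sub>R rot \<theta> (1, u2 / u1)"
      by (metis linear_cmul[OF linear_rot] rot_minus_cancel(2))
    then show thesis by (rule found[OF \<theta> \<open>u2 / u1 \<in> {0..1}\<close>])
  qed
  obtain x y where v: "v = (x, y)" by (cases v)
  let ?k = "sqrt 2 / 2"
  have "3 * pi / 4 = pi / 4 + pi / 2" by simp
  then have cs: "cos (3 * pi / 4) = - ?k" "sin (3 * pi / 4) = ?k"
    by (simp_all only: cos_add sin_add cos_45 sin_45 cos_pi_half sin_pi_half)
  have scaled: "0 \<le> ?k * a * (?k * b)" if "0 \<le> a * b" for a b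
    using that by (simp add: mult.commute mult.left_commute)
  have sq: "\<bar>a\<bar> \<le> \<bar>b\<bar> \<Longrightarrow> a * a \<le> b * b" for a b :: real
    using abs_le_square_iff[of a b] by (simp add: power2_eq_square)
  have qs: "a * a \<le> b * b \<Longrightarrow> \<bar>a\<bar> \<le> \<bar>b\<bar>" for a b :: real
    using abs_le_square_iff[of a b] by (simp add: power2_eq_square)
  have r0: "rot (- 0) v = (x, y)" by (simp add: rot_def v)
  have r1: "rot (- (pi / 4)) v = (?k * (x + y), ?k * (y - x))"
    by (simp add: rot_def v cos_45 sin_45 algebra_simps)
  have r2: "rot (- (pi / 2)) v = (y, - x)" by (simp add: rot_def v)
  have r3: "rot (- (3 * pi / 4)) v = (?k * (y - x), ?k * (- x - y))"
    unfolding rot_def v cos_minus sin_minus case_prod_conv cs by (simp add: algebra_simps)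
  \<comment> \<open>The four double sectors, in the order of the angles 0, \<pi>\<open>/ 4\<close>,
    \<pi>\<open>/ 2\<close>, \<open>3\<close>\<pi>\<open>/ 4\<close>.\<close>
  consider "0 \<le> x * y" "\<bar>y\<bar> \<le> \<bar>x\<bar>" | "0 \<le> x * y" "\<bar>x\<bar> \<le> \<bar>y\<bar>"
    | "x * y \<le> 0" "\<bar>x\<bar> \<le> \<bar>y\<bar>" | "x * y \<le> 0" "\<bar>y\<bar> \<le> \<bar>x\<bar>" by linarith
  then show thesis
  proof cases
    case 1
    then show thesis by (intro *[OF _ r0]) (auto simp: four_angles_def)
  next
    case 2
    have "0 \<le> (x + y) * (y - x)" using sq[OF 2(2)] by (simp add: algebra_simps)
    moreover have "\<bar>y - x\<bar> \<le> \<bar>x + y\<bar>" using 2(1) by (intro qs) (simp add: algebra_simps)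
    ultimately show thesis
      by (intro *[OF _ r1] scaled) (auto simp: four_angles_def abs_mult)
  next
    case 3
    then show thesis by (intro *[OF _ r2]) (auto simp: four_angles_def mult.commute)
  next
    case 4
    have "0 \<le> (y - x) * (- x - y)" using sq[OF 4(2)] by (simp add: algebra_simps)
    moreover have "\<bar>- x - y\<bar> \<le> \<bar>y - x\<bar>" using 4(1) by (intro qs) (simp add: algebra_simps)
    ultimately show thesis
      by (intro *[OF _ r3] scaled) (auto simp: four_angles_def abs_mult)
  qed
qed

lemma line_scaleR_subset: "line p (k *\<^sub>R v) \<subseteq> line p v"
  unfolding line_def by auto

lemma besicovitch_four_rotations_dual:
  assumes "fst ` K = {0..1}"
  shows "besicovitch_set (\<Union>(four_rotations (dual K)))"
  unfolding besicovitch_set_def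
proof (intro allI impI)
  fix v :: "real \<times> real" assume "v \<noteq> 0"
  then obtain \<theta> k a where \<theta>: "\<theta> \<in> four_angles" "a \<in> {0..1}" "v = k *\<^sub>R rot \<theta> (1, a)"
    by (rule four_angles_directions)
  then obtain b where "(a, b) \<in> K" using assms by force
  then have "rot \<theta> ` l a b \<in> four_rotations (dual K)"
    using \<theta>(1) by (auto simp: four_rotations_def dual_def)
  moreover have "line (rot \<theta> (0, b)) v \<subseteq> rot \<theta> ` l a b"
    unfolding l_eq_line rot_line \<theta>(3) by (rule line_scaleR_subset)
  ultimately show "\<exists>p. line p v \<subseteq> \<Union>(four_rotations (dual K))" by blast
qed

text \<open>Covers properties (3) and (4) together, since removing \<open>e\<close> changes nothing
  when \<open>e\<close> is not in the family. Rotating back by each of the four angles reduces the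
  claim to \<open>thin_dual_meets_line\<close>.\<close>

lemma thin_null_on_line:
  assumes "thin K" "is_line e"
  shows "null_on_line e (e \<inter> \<Union>(four_rotations (dual K) - {e}))"
proof -
  obtain p w where w: "w \<noteq> 0" "e = line p w" using assms(2) by (auto simp: is_line_def)
  define v where "v = (1 / norm w) *\<^sub>R w"
  have v: "norm v = 1" using w(1) by (simp add: v_def)
  have "w = norm w *\<^sub>R v" using w(1) by (simp add: v_def)
  then have "line p w \<subseteq> line p v" using line_scaleR_subset by metis
  moreover have "line p v \<subseteq> line p w" unfolding v_def by (rule line_scaleR_subset)
  ultimately have e: "e = line p v" using w(2) by blast
  let ?N = "\<lambda>\<theta>. {t. rot (- \<theta>) p + t *\<^sub>R rot (- \<theta>) v \<in> \<Union>(dual K - {line (rot (- \<theta>) p) (rot (- \<theta>) v)})}"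
  have "{t. p + t *\<^sub>R v \<in> e \<inter> \<Union>(four_rotations (dual K) - {e})} \<subseteq> (\<Union>\<theta>\<in>four_angles. ?N \<theta>)"
  proof
    fix t assume "t \<in> {t. p + t *\<^sub>R v \<in> e \<inter> \<Union>(four_rotations (dual K) - {e})}"
    then obtain f where "f \<in> four_rotations (dual K)" "f \<noteq> e" "p + t *\<^sub>R v \<in> f" by blast
    then obtain \<theta> g where \<theta>: "\<theta> \<in> four_angles" "g \<in> dual K" "p + t *\<^sub>R v \<in> rot \<theta> ` g" "rot \<theta> ` g \<noteq> e"
      unfolding four_rotations_def by blast
    have "rot (- \<theta>) (p + t *\<^sub>R v) \<in> g" using \<theta>(3) by (metis imageE rot_minus_cancel(1))
    then have "rot (- \<theta>) p + t *\<^sub>R rot (- \<theta>) v \<in> g"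
      by (simp add: linear_add[OF linear_rot] linear_cmul[OF linear_rot])
    \<comment> \<open>A line other than \<open>e\<close> stays different from the rotated-back
      \<open>e\<close>, so exactly the right line is removed in \<open>?N\<close> \<theta>.\<close>
    moreover have "g \<noteq> line (rot (- \<theta>) p) (rot (- \<theta>) v)"
    proof
      assume "g = line (rot (- \<theta>) p) (rot (- \<theta>) v)"
      then have "rot \<theta> ` g = e" by (simp only: e rot_line rot_minus_cancel)
      with \<theta>(4) show False by contradiction
    qed
    ultimately show "t \<in> (\<Union>\<theta>\<in>four_angles. ?N \<theta>)" using \<theta>(1,2) by blast
  qed
  moreover have "negligible (?N \<theta>)" for \<theta>
    by (rule thin_dual_meets_line[OF assms(1)]) (use v in auto)
  then have "negligible (\<Union>\<theta>\<in>four_angles. ?N \<theta>)"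
    by (intro negligible_Union finite_imageI finite_four_angles) blast
  ultimately have "negligible {t. p + t *\<^sub>R v \<in> e \<inter> \<Union>(four_rotations (dual K) - {e})}"
    by (rule negligible_subset[rotated])
  then show ?thesis
    using null_on_line_iff[OF v, of p] by (simp add: e negligible_iff_null_sets)
qed

lemma small_line_intersections_four_rotations_dual:
  assumes "compact K" "thin K"
  shows "small_line_intersections (four_rotations (dual K))"
  unfolding small_line_intersections_def
proof (intro conjI allI ballI impI)
  let ?L = "four_rotations (dual K)"
  show "closed (\<Union>?L)"
    unfolding Union_four_rotations
    by (intro closed_UN finite_four_angles ballI closed_rot_image closed_Union_dual assms)
  show "\<Union>?L \<in> null_sets lebesgue"
    unfolding Union_four_rotations negligible_iff_null_sets[symmetric]
    by (intro negligible_Union finite_imageI finite_four_angles)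
       (use assms in \<open>auto intro!: negligible_rot_image negligible_Union_dual\<close>)
  show "null_on_line e (\<Union>?L \<inter> e)" if "is_line e \<and> e \<notin> ?L" for e
    using thin_null_on_line[OF assms(2), of e] that by (simp add: Int_commute)
  show "null_on_line e (e \<inter> \<Union>(?L - {e}))" if "e \<in> ?L" for e
    by (rule thin_null_on_line[OF assms(2) is_line_four_rotations_dual[OF that]])
qed

theorem theorem3p1:
  shows "(\<exists>L :: (real \<times> real) set set.
            (\<forall>e\<in>L. is_line e) \<and> besicovitch_set (\<Union>L) \<and> small_line_intersections L) \<and>
         typical_in CC_topology
           (\<lambda>K'. let L' = dual K'; L = four_rotations L'; B = \<Union>L in
              B = (\<Union>\<theta>\<in>four_angles. rot \<theta> ` \<Union>L') \<and>
              besicovitch_set B \<and> small_line_intersections L)"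
proof
  have good: "besicovitch_set (\<Union>(four_rotations (dual K)))"
    "small_line_intersections (four_rotations (dual K))" if "K \<in> CC" "thin K" for K
    using that besicovitch_four_rotations_dual small_line_intersections_four_rotations_dual
    by (auto simp: CC_def)
  \<comment> \<open>Existence is taken from the nested construction behind \<open>ex_thin\<close>,
    not from typicality.\<close>
  obtain K where "K \<in> CC" "thin K" using ex_thin by blast
  with good[of K] show "\<exists>L :: (real \<times> real) set set.
      (\<forall>e\<in>L. is_line e) \<and> besicovitch_set (\<Union>L) \<and> small_line_intersections L"
    using is_line_four_rotations_dual by blast
  show "typical_in CC_topology
           (\<lambda>K'. let L' = dual K'; L = four_rotations L'; B = \<Union>L in
              B = (\<Union>\<theta>\<in>four_angles. rot \<theta> ` \<Union>L') \<and>
              besicovitch_set B \<and> small_line_intersections L)"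
  proof (rule typical_if_robustly_dense[OF countable_thinness_conditions robustly_dense_thinness_conditions])
    fix K assume "K \<in> CC" and "\<And>Q. Q \<in> thinness_conditions \<Longrightarrow> Q K"
    then have "thin K" by (intro thin_if_conditions ballI)
    with \<open>K \<in> CC\<close> show "let L' = dual K; L = four_rotations L'; B = \<Union>L in
              B = (\<Union>\<theta>\<in>four_angles. rot \<theta> ` \<Union>L') \<and>
              besicovitch_set B \<and> small_line_intersections L"
      unfolding Let_def by (intro conjI Union_four_rotations good)
  qed
qed

end
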